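(* Let $L$ be a Minkowski plane whose unit ball is a parallelogram, with metric $d_L$. Let $T_S$ be a $d_L$-SMT and let $T_{\mathrm{opt}}$ be a $d_L$-MSPT on a set of three embedded terminals $\{\mathbf{t}_1,\mathbf{t}_2,\mathbf{t}_3\}$. Then $$\mathrm{beads}(T_S)\le \mathrm{beads}(T_{\mathrm{opt}})+1 .$$
   Context: A Minkowski plane is $\mathbb{R}^2$ with a norm. Its unit ball is the set of vectors of norm at most 1. Its metric $d$ is the one induced by the norm, and $|e|=d(x,y)$ for an edge $e=xy$. A tree interconnecting a finite terminal set $N$ is an embedded tree with node set $N\cup W$, where $W$ is a finite set of additional nodes (Steiner points, or Steiner beads), each of degree at least three. Nodes may coincide in position. A $d$-SMT on $N$ is a tree interconnecting $N$ of minimum total $d$-length. For a tree $T$ interconnecting $N$ with $|N|=n\ge2$, $T^*$ denotes the tree obtained by splitting nodes of $T$ until every terminal has degree one and every Steiner point has degree three. To split a node $v$ means to disconnect two or more edges at $v$, connect them instead to a new Steiner point, and join this new point to $v$ by an extra edge. New nodes keep their original position, so the extra edges have length zero. $T^*$ has $m=2n-3$ edges $e_1,\dots,e_m$. The bead count is $\mathrm{beads}(T)=1-n+\sum_{i=1}^m\lceil|e_i|\rceil$. A $d$-MSPT on $N$ is a tree interconnecting $N$ that minimizes $\mathrm{beads}$ over all trees interconnecting $N$. *)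

theory Defs
  imports "HOL-Analysis.Analysis"
begin

section \<open>Minkowski planes\<close>

text \<open>A Minkowski plane is given by a norm \<^term>\<open>\<nu>\<close> on \<^typ>\<open>real ^ 2\<close>, passed around as a function because
  the type already carries the Euclidean norm.\<close>

definition is_norm :: "(real ^ 2 \<Rightarrow> real) \<Rightarrow> bool" where
  "is_norm \<nu> \<longleftrightarrow>
     (\<forall>x. 0 \<le> \<nu> x) \<and> (\<forall>x. \<nu> x = 0 \<longleftrightarrow> x = 0) \<and>
     (\<forall>c x. \<nu> (c *\<^sub>R x) = \<bar>c\<bar> * \<nu> x) \<and> (\<forall>x y. \<nu> (x + y) \<le> \<nu> x + \<nu> y)"

definition metric_of :: "(real ^ 2 \<Rightarrow> real) \<Rightarrow> real ^ 2 \<Rightarrow> real ^ 2 \<Rightarrow> real" where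
  "metric_of \<nu> x y = \<nu> (x - y)"

definition unit_ball :: "(real ^ 2 \<Rightarrow> real) \<Rightarrow> (real ^ 2) set" where
  "unit_ball \<nu> = {x. \<nu> x \<le> 1}"

text \<open>The condition \<^prop>\<open>a + c = b + d\<close> says that the diagonals \<open>ac\<close> and \<open>bd\<close> bisect each other.\<close>

definition is_parallelogram :: "(real ^ 2) set \<Rightarrow> bool" where
  "is_parallelogram S \<longleftrightarrow>
     (\<exists>a b c d. a + c = b + d \<and> \<not> collinear {a, b, c} \<and> S = convex hull {a, b, c, d})"

section \<open>Trees\<close>

definition is_cycle :: "'v set set \<Rightarrow> 'v list \<Rightarrow> bool" where
  "is_cycle E vs \<longleftrightarrow> 3 \<le> length vs \<and> distinct vs \<and>
     (\<forall>i < length vs. {vs ! i, vs ! (Suc i mod length vs)} \<in> E)"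

definition is_tree :: "'v set \<Rightarrow> 'v set set \<Rightarrow> bool" where
  "is_tree V E \<longleftrightarrow> finite V \<and> V \<noteq> {} \<and>
     E \<subseteq> {{u, v} | u v. u \<in> V \<and> v \<in> V \<and> u \<noteq> v} \<and>
     (\<forall>u \<in> V. \<forall>v \<in> V. (u, v) \<in> {(x, y). {x, y} \<in> E}\<^sup>*) \<and>
     (\<nexists>vs. is_cycle E vs)"

section \<open>Trees interconnecting embedded terminals\<close>

text \<open>Nodes are labels, and positions are assigned separately, so that distinct nodes may coincide in
  position. Terminals come from an arbitrary type; the labels of the finitely many Steiner points are
  natural numbers, so a fresh one is always available.\<close>

datatype 't node = Terminal 't | Steiner nat

record 't net =
  steiner :: "nat set"
  edges :: "'t node set set"
  pos :: "'t node \<Rightarrow> real ^ 2"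

definition nodes :: "'t set \<Rightarrow> 't net \<Rightarrow> 't node set" where
  "nodes N T = Terminal ` N \<union> Steiner ` steiner T"

definition edges_at :: "'t net \<Rightarrow> 't node \<Rightarrow> 't node set set" where
  "edges_at T v = {e \<in> edges T. v \<in> e}"

definition degree :: "'t net \<Rightarrow> 't node \<Rightarrow> nat" where
  "degree T v = card (edges_at T v)"

definition interconnects :: "'t set \<Rightarrow> ('t \<Rightarrow> real ^ 2) \<Rightarrow> 't net \<Rightarrow> bool" where
  "interconnects N p T \<longleftrightarrow>
     is_tree (nodes N T) (edges T) \<and>
     (\<forall>t \<in> N. pos T (Terminal t) = p t) \<and>
     (\<forall>s \<in> steiner T. 3 \<le> degree T (Steiner s))"

definition edge_length :: "(real ^ 2 \<Rightarrow> real) \<Rightarrow> 't net \<Rightarrow> 't node set \<Rightarrow> real" where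
  "edge_length \<nu> T e = (THE l. \<exists>u v. e = {u, v} \<and> l = metric_of \<nu> (pos T u) (pos T v))"

definition is_SMT :: "(real ^ 2 \<Rightarrow> real) \<Rightarrow> 't set \<Rightarrow> ('t \<Rightarrow> real ^ 2) \<Rightarrow> 't net \<Rightarrow> bool" where
  "is_SMT \<nu> N p T \<longleftrightarrow> interconnects N p T \<and>
     (\<forall>T'. interconnects N p T' \<longrightarrow>
        (\<Sum>e \<in> edges T. edge_length \<nu> T e) \<le> (\<Sum>e \<in> edges T'. edge_length \<nu> T' e))"

section \<open>Splitting and the bead count\<close>

text \<open>The edges in \<open>F\<close> are moved from \<open>v\<close> to the new Steiner point \<open>s\<close>, which is placed at the position
  of \<open>v\<close> and joined to \<open>v\<close>.\<close>

inductive split_node :: "'t set \<Rightarrow> 't net \<Rightarrow> 't net \<Rightarrow> bool" for N where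
  "\<lbrakk>v \<in> nodes N T; F \<subseteq> edges_at T v; 2 \<le> card F; s \<notin> steiner T\<rbrakk> \<Longrightarrow>
   split_node N T
     (T\<lparr>steiner := insert s (steiner T),
        edges := (edges T - F) \<union> (\<lambda>e. insert (Steiner s) (e - {v})) ` F \<union> {{Steiner s, v}},
        pos := (pos T)(Steiner s := pos T v)\<rparr>)"

definition full_splitting :: "'t set \<Rightarrow> 't net \<Rightarrow> 't net \<Rightarrow> bool" where
  "full_splitting N T T' \<longleftrightarrow> (split_node N)\<^sup>*\<^sup>* T T' \<and>
     (\<forall>t \<in> N. degree T' (Terminal t) = 1) \<and>
     (\<forall>s \<in> steiner T'. degree T' (Steiner s) = 3)"

text \<open>Splitting to the end can be done in several ways, but only edges of length zero are ever
  added, so the bead count does not depend on the choice.\<close>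

definition fully_split :: "'t set \<Rightarrow> 't net \<Rightarrow> 't net" where
  "fully_split N T = (SOME T'. full_splitting N T T')"

definition beads :: "(real ^ 2 \<Rightarrow> real) \<Rightarrow> 't set \<Rightarrow> 't net \<Rightarrow> int" where
  "beads \<nu> N T = 1 - int (card N) +
     (\<Sum>e \<in> edges (fully_split N T). \<lceil>edge_length \<nu> (fully_split N T) e\<rceil>)"

definition is_MSPT :: "(real ^ 2 \<Rightarrow> real) \<Rightarrow> 't set \<Rightarrow> ('t \<Rightarrow> real ^ 2) \<Rightarrow> 't net \<Rightarrow> bool" where
  "is_MSPT \<nu> N p T \<longleftrightarrow> interconnects N p T \<and>
     (\<forall>T'. interconnects N p T' \<longrightarrow> beads \<nu> N T \<le> beads \<nu> N T')"

end

theory Submission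
  imports Defs
begin

text \<open>A full splitting of a tree on three terminals is a star, so both the length and the bead count
  are determined by the position \<open>q\<close> of its centre. If the unit ball is a parallelogram, then in
  suitable coordinates the norm is the \<open>\<ell>\<^sub>1\<close> norm and the coordinatewise median of the terminals
  lies on a shortest path between any two of them. Hence the distances \<open>a\<^sub>i\<close> from the centre of a
  Steiner minimal tree to the terminals satisfy \<open>a\<^sub>i + a\<^sub>j = d(t\<^sub>i, t\<^sub>j)\<close>, whereas
  \<open>b\<^sub>i + b\<^sub>j \<ge> d(t\<^sub>i, t\<^sub>j)\<close> for every star. Therefore
  \<open>\<lceil>a\<^sub>i\<rceil> + \<lceil>a\<^sub>j\<rceil> \<le> \<lceil>b\<^sub>i\<rceil> + \<lceil>b\<^sub>j\<rceil> + 1\<close>; adding the three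
  inequalities and halving, the bead count of the Steiner minimal tree exceeds that of any other tree
  by at most \<open>3/2\<close>, hence by at most \<open>1\<close>.\<close>

section \<open>Parallelogram norms: l1 coordinates and medians\<close>

lemma is_norm_minus:
  assumes "is_norm \<nu>"
  shows "\<nu> (- x) = \<nu> x"
proof -
  have "\<nu> ((- 1) *\<^sub>R x) = \<bar>- 1\<bar> * \<nu> x"
    using assms unfolding is_norm_def by blast
  then show ?thesis by simp
qed

lemma is_norm_commute:
  assumes "is_norm \<nu>"
  shows "\<nu> (x - y) = \<nu> (y - x)"
  using is_norm_minus[OF assms, of "x - y"] by simp

lemma is_norm_diff_triangle:
  assumes "is_norm \<nu>"
  shows "\<nu> (x - y) \<le> \<nu> (x - z) + \<nu> (y - z)"
proof -
  have "\<nu> ((x - z) + (z - y)) \<le> \<nu> (x - z) + \<nu> (z - y)"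
    using assms unfolding is_norm_def by blast
  then show ?thesis using is_norm_commute[OF assms, of z y] by simp
qed

lemma in_parallelogram:
  fixes a b c d x :: "'a::real_vector"
  assumes "x \<in> convex hull {a, b, c, d}"
  obtains u v w z where "0 \<le> u" "0 \<le> v" "0 \<le> w" "0 \<le> z" "u + v + w + z = (1::real)"
    "x = u *\<^sub>R a + v *\<^sub>R b + w *\<^sub>R c + z *\<^sub>R d"
proof -
  obtain u r y where 1: "0 \<le> u" "0 \<le> r" "u + r = 1" "y \<in> convex hull {b, c, d}"
      "x = u *\<^sub>R a + r *\<^sub>R y"
    using assms by (auto simp: convex_hull_insert[of "{b, c, d}"])
  obtain v w z where 2: "0 \<le> v" "0 \<le> w" "0 \<le> z" "v + w + z = 1"
      "y = v *\<^sub>R b + w *\<^sub>R c + z *\<^sub>R d"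
    using 1(4) by (auto simp: convex_hull_3)
  show thesis
  proof
    show "0 \<le> u" "0 \<le> r * v" "0 \<le> r * w" "0 \<le> r * z" using 1 2 by auto
    show "u + r * v + r * w + r * z = 1"
      using 1(3) 2(4) by (simp add: distrib_left[symmetric] add.assoc)
    show "x = u *\<^sub>R a + (r * v) *\<^sub>R b + (r * w) *\<^sub>R c + (r * z) *\<^sub>R d"
      using 1(5) 2(5) by (simp add: algebra_simps)
  qed
qed

text \<open>The reflection in the common midpoint of the diagonals swaps \<open>a\<close> with
  \<open>c\<close> and \<open>b\<close> with \<open>d\<close>, so it only permutes the weights of a
  convex combination.\<close>

lemma parallelogram_reflect:
  fixes a b c d x :: "'a::real_vector"
  assumes "a + c = b + d" "x \<in> convex hull {a, b, c, d}"
  shows "a + c - x \<in> convex hull {a, b, c, d}"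
proof -
  obtain u v w z where 1: "0 \<le> u" "0 \<le> v" "0 \<le> w" "0 \<le> z" "u + v + w + z = (1::real)"
    "x = u *\<^sub>R a + v *\<^sub>R b + w *\<^sub>R c + z *\<^sub>R d"
    using in_parallelogram[OF assms(2)] by blast
  have "a + c - x = (u + v + w + z) *\<^sub>R (a + c) - x" using 1 by simp
  also have "\<dots> = u *\<^sub>R c + v *\<^sub>R (a + c - b) + w *\<^sub>R a + z *\<^sub>R (a + c - d)"
    by (simp add: 1(6) algebra_simps)
  also have "\<dots> = u *\<^sub>R c + v *\<^sub>R d + w *\<^sub>R a + z *\<^sub>R b"
    using assms(1) by (simp add: algebra_simps)
  finally have eq: "a + c - x = w *\<^sub>R a + z *\<^sub>R b + u *\<^sub>R c + v *\<^sub>R d"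
    by (simp add: algebra_simps)
  let ?H = "convex hull {a, b, c, d}"
  have H: "a \<in> ?H" "b \<in> ?H" "c \<in> ?H" "d \<in> ?H" by (auto intro: hull_inc)
  \<comment> \<open>Indexing by position instead of by point keeps the weights separate even if some
    of the four vertices coincide.\<close>
  have "(\<Sum>i<4. [w,z,u,v] ! i *\<^sub>R [a,b,c,d] ! i) \<in> ?H"
  proof (rule convex_sum)
    show "(\<Sum>i<4. [w,z,u,v] ! i) = 1" using 1(5) by (simp add: numeral_eq_Suc)
    fix i :: nat assume "i \<in> {..<4}"
    then have "i = 0 \<or> i = 1 \<or> i = 2 \<or> i = 3" by auto
    then show "0 \<le> [w,z,u,v] ! i" "[a,b,c,d] ! i \<in> ?H" using 1 H by auto
  qed auto
  then show ?thesis by (simp add: eq numeral_eq_Suc)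
qed

text \<open>The ball is symmetric about the origin and about the centre of the parallelogram.
  Composing the two reflections gives the translation by \<open>a + c\<close>, which therefore maps
  the ball into itself. Iterating it from the origin would leave the ball unless
  \<open>a + c = 0\<close>.\<close>

lemma unit_ball_parallelogram_centre:
  assumes "is_norm \<nu>" "a + c = b + d" "unit_ball \<nu> = convex hull {a, b, c, d}"
  shows "a + c = 0"
proof -
  let ?m = "a + c"
  have step: "x + ?m \<in> unit_ball \<nu>" if "x \<in> unit_ball \<nu>" for x
  proof -
    have "- x \<in> unit_ball \<nu>"
      using that is_norm_minus[OF assms(1)] by (simp add: unit_ball_def)
    then show ?thesis
      using parallelogram_reflect[OF assms(2), of "- x"] assms(3) by (simp add: algebra_simps)
  qed
  have in_ball: "real k *\<^sub>R ?m \<in> unit_ball \<nu>" for k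
  proof (induction k)
    case 0
    have "\<nu> 0 = 0" using assms(1) unfolding is_norm_def by blast
    then show ?case by (simp add: unit_ball_def)
  next
    case (Suc k)
    then show ?case using step[of "real k *\<^sub>R ?m"] by (simp add: scaleR_left_distrib add.commute)
  qed
  have le1: "real k * \<nu> ?m \<le> 1" for k
    using in_ball[of k] assms(1) by (simp add: unit_ball_def is_norm_def)
  have "\<not> 0 < \<nu> ?m"
  proof
    assume "0 < \<nu> ?m"
    then obtain k where "1 < real k * \<nu> ?m" using reals_Archimedean3 by blast
    then show False using le1[of k] by simp
  qed
  then have "\<nu> ?m = 0" using assms(1) unfolding is_norm_def by (metis less_eq_real_def)
  then show ?thesis using assms(1) unfolding is_norm_def by blast
qed

text \<open>Once the centre is the origin, the vertices are \<open>a\<close>, \<open>b\<close>,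
  \<open>- a\<close>, \<open>- b\<close>. Their hull is the l1 unit ball in the basis of the
  half-diagonals \<open>a\<close> and \<open>b\<close>.\<close>

lemma parallelogram_norm_coordinates:
  assumes "is_norm \<nu>" "is_parallelogram (unit_ball \<nu>)"
  obtains a b where "\<And>r s. \<nu> (r *\<^sub>R a + s *\<^sub>R b) = \<bar>r\<bar> + \<bar>s\<bar>"
    "\<And>x. \<exists>r s. x = r *\<^sub>R a + s *\<^sub>R b"
proof -
  note N = assms(1)[unfolded is_norm_def]
  obtain a b c d where 1: "a + c = b + d" "\<not> collinear {a, b, c}"
      and ball: "unit_ball \<nu> = convex hull {a, b, c, d}"
    using assms(2) unfolding is_parallelogram_def by blast
  have "a + c = 0" by (rule unit_ball_parallelogram_centre[OF assms(1) 1(1) ball])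
  with 1(1) have cd: "c = - a" "d = - b" by (simp_all add: eq_neg_iff_add_eq_0 add.commute)
  \<comment> \<open>A linear dependence would put \<open>a\<close>, \<open>b\<close> and
    \<open>- a\<close> on one line through the origin, contrary to the parallelogram being
    nondegenerate.\<close>
  have indep: "r = 0 \<and> s = 0" if 0: "r *\<^sub>R a + s *\<^sub>R b = 0" for r s
  proof (rule ccontr)
    assume "\<not> (r = 0 \<and> s = 0)"
    then consider "r \<noteq> 0" | "s \<noteq> 0" by blast
    then have "\<exists>u k l. a = k *\<^sub>R u \<and> b = l *\<^sub>R u"
    proof cases
      case 1
      have "a = (1 / r) *\<^sub>R (r *\<^sub>R a)" using 1 by simp
      also have "r *\<^sub>R a = - (s *\<^sub>R b)" using 0 by (simp add: eq_neg_iff_add_eq_0)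
      finally have "a = (- s / r) *\<^sub>R b" by simp
      then show ?thesis by (metis scaleR_one)
    next
      case 2
      have "b = (1 / s) *\<^sub>R (s *\<^sub>R b)" using 2 by simp
      also have "s *\<^sub>R b = - (r *\<^sub>R a)" using 0 by (simp add: eq_neg_iff_add_eq_0 add.commute)
      finally have "b = (- r / s) *\<^sub>R a" by simp
      then show ?thesis by (metis scaleR_one)
    qed
    then obtain u k l where u: "a = k *\<^sub>R u" "b = l *\<^sub>R u" by blast
    have "collinear {a, b, c}"
      unfolding collinear_def cd(1)
    proof (rule exI[of _ u], intro ballI)
      fix x y assume "x \<in> {a, b, - a}" "y \<in> {a, b, - a}"
      then have "\<exists>i. x = i *\<^sub>R u" "\<exists>j. y = j *\<^sub>R u"
        using u by (auto simp flip: scaleR_minus_left)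
      then show "\<exists>t. x - y = t *\<^sub>R u" by (metis scaleR_left_diff_distrib)
    qed
    with 1(2) show False by blast
  qed
  \<comment> \<open>Scale \<open>x\<close> to norm one and write it as a convex combination of the
    vertices. Opposite vertices combine to the coordinates \<open>u - w\<close> and
    \<open>v - z\<close>, whose absolute values add up to at most 1.\<close>
  have rep: "\<exists>r s. x = r *\<^sub>R a + s *\<^sub>R b \<and> \<bar>r\<bar> + \<bar>s\<bar> \<le> \<nu> x" for x
  proof (cases "x = 0")
    case True
    then show ?thesis using N by (intro exI[of _ 0]) simp
  next
    case False
    define R where "R = \<nu> x"
    have R: "0 < R" using N False unfolding R_def by (metis less_eq_real_def)
    have "\<nu> ((1 / R) *\<^sub>R x) = \<bar>1 / R\<bar> * \<nu> x" using N by blast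
    then have "(1 / R) *\<^sub>R x \<in> unit_ball \<nu>" using R by (simp add: unit_ball_def flip: R_def)
    then obtain u v w z where h: "0 \<le> u" "0 \<le> v" "0 \<le> w" "0 \<le> z" "u + v + w + z = 1"
        "(1 / R) *\<^sub>R x = u *\<^sub>R a + v *\<^sub>R b + w *\<^sub>R c + z *\<^sub>R d"
      unfolding ball using in_parallelogram by blast
    have "x = R *\<^sub>R ((1 / R) *\<^sub>R x)" using R by simp
    also have "\<dots> = (R * (u - w)) *\<^sub>R a + (R * (v - z)) *\<^sub>R b"
      unfolding h(6) cd by (simp add: algebra_simps)
    finally have "x = (R * (u - w)) *\<^sub>R a + (R * (v - z)) *\<^sub>R b" .
    moreover have "\<bar>R * (u - w)\<bar> + \<bar>R * (v - z)\<bar> = R * (\<bar>u - w\<bar> + \<bar>v - z\<bar>)"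
      using R by (simp add: abs_mult distrib_left)
    moreover have "\<dots> \<le> R * 1" using R h by (intro mult_left_mono) auto
    ultimately show ?thesis unfolding R_def by (metis mult.right_neutral)
  qed
  have "\<nu> (r *\<^sub>R a + s *\<^sub>R b) = \<bar>r\<bar> + \<bar>s\<bar>" for r s
  proof (rule antisym)
    have "a \<in> unit_ball \<nu>" "b \<in> unit_ball \<nu>" unfolding ball by (auto intro: hull_inc)
    then have "\<nu> a \<le> 1" "\<nu> b \<le> 1" by (auto simp: unit_ball_def)
    then have "\<bar>r\<bar> * \<nu> a + \<bar>s\<bar> * \<nu> b \<le> \<bar>r\<bar> * 1 + \<bar>s\<bar> * 1"
      by (intro add_mono mult_left_mono) auto
    moreover have "\<nu> (r *\<^sub>R a + s *\<^sub>R b) \<le> \<bar>r\<bar> * \<nu> a + \<bar>s\<bar> * \<nu> b" using N by metis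
    ultimately show "\<nu> (r *\<^sub>R a + s *\<^sub>R b) \<le> \<bar>r\<bar> + \<bar>s\<bar>" by simp
    \<comment> \<open>The coordinates supplied by \<open>rep\<close> may be a priori different ones;
      linear independence identifies them with \<open>r\<close> and \<open>s\<close>.\<close>
    obtain r' s' where rs: "r *\<^sub>R a + s *\<^sub>R b = r' *\<^sub>R a + s' *\<^sub>R b"
        and le: "\<bar>r'\<bar> + \<bar>s'\<bar> \<le> \<nu> (r *\<^sub>R a + s *\<^sub>R b)"
      using rep by blast
    have "(r - r') *\<^sub>R a + (s - s') *\<^sub>R b = 0"
      using rs by (simp add: algebra_simps)
    then have "r = r'" "s = s'" using indep by fastforce+
    then show "\<bar>r\<bar> + \<bar>s\<bar> \<le> \<nu> (r *\<^sub>R a + s *\<^sub>R b)" using le by simp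
  qed
  then show thesis using that rep by blast
qed

lemma real_median:
  fixes x y z :: real
  obtains m where "\<bar>x - m\<bar> + \<bar>y - m\<bar> = \<bar>x - y\<bar>" "\<bar>y - m\<bar> + \<bar>z - m\<bar> = \<bar>y - z\<bar>"
    "\<bar>x - m\<bar> + \<bar>z - m\<bar> = \<bar>x - z\<bar>"
proof -
  consider "y \<le> x \<and> x \<le> z \<or> z \<le> x \<and> x \<le> y" | "x \<le> y \<and> y \<le> z \<or> z \<le> y \<and> y \<le> x"
    | "x \<le> z \<and> z \<le> y \<or> y \<le> z \<and> z \<le> x"
    by linarith
  then show thesis
  proof cases
    case 1
    then show ?thesis by (intro that[of x]) auto
  next
    case 2
    then show ?thesis by (intro that[of y]) auto
  next
    case 3
    then show ?thesis by (intro that[of z]) auto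
  qed
qed

lemma parallelogram_norm_median:
  assumes "is_norm \<nu>" "is_parallelogram (unit_ball \<nu>)"
  obtains m where "\<nu> (x - m) + \<nu> (y - m) = \<nu> (x - y)" "\<nu> (y - m) + \<nu> (z - m) = \<nu> (y - z)"
    "\<nu> (x - m) + \<nu> (z - m) = \<nu> (x - z)"
proof -
  obtain a b where ab: "\<And>r s. \<nu> (r *\<^sub>R a + s *\<^sub>R b) = \<bar>r\<bar> + \<bar>s\<bar>"
      and span: "\<And>x. \<exists>r s. x = r *\<^sub>R a + s *\<^sub>R b"
    using parallelogram_norm_coordinates[OF assms] by metis
  obtain r s where rs: "\<And>x. x = r x *\<^sub>R a + s x *\<^sub>R b" using span by metis
  have dist: "\<nu> (x - (i *\<^sub>R a + j *\<^sub>R b)) = \<bar>r x - i\<bar> + \<bar>s x - j\<bar>" for x i j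
  proof -
    have "x - (i *\<^sub>R a + j *\<^sub>R b) = (r x - i) *\<^sub>R a + (s x - j) *\<^sub>R b"
      by (subst rs[of x]) (simp add: algebra_simps)
    then show ?thesis by (simp add: ab)
  qed
  obtain i where i: "\<bar>r x - i\<bar> + \<bar>r y - i\<bar> = \<bar>r x - r y\<bar>" "\<bar>r y - i\<bar> + \<bar>r z - i\<bar> = \<bar>r y - r z\<bar>"
      "\<bar>r x - i\<bar> + \<bar>r z - i\<bar> = \<bar>r x - r z\<bar>"
    using real_median .
  obtain j where j: "\<bar>s x - j\<bar> + \<bar>s y - j\<bar> = \<bar>s x - s y\<bar>" "\<bar>s y - j\<bar> + \<bar>s z - j\<bar> = \<bar>s y - s z\<bar>"
      "\<bar>s x - j\<bar> + \<bar>s z - j\<bar> = \<bar>s x - s z\<bar>"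
    using real_median .
  have dist2: "\<nu> (x - y) = \<bar>r x - r y\<bar> + \<bar>s x - s y\<bar>" for x y
    using dist[of x "r y" "s y"] rs[of y] by simp
  show thesis
    by (rule that[of "i *\<^sub>R a + j *\<^sub>R b"]; unfold dist, unfold dist2)
      (simp_all add: ac_simps flip: i j)
qed

section \<open>Rounding pairwise inequalities\<close>

lemma sum_ceiling_le_of_pairwise:
  fixes a\<^sub>1 a\<^sub>2 a\<^sub>3 b\<^sub>1 b\<^sub>2 b\<^sub>3 :: real
  assumes "a\<^sub>1 + a\<^sub>2 \<le> b\<^sub>1 + b\<^sub>2" "a\<^sub>2 + a\<^sub>3 \<le> b\<^sub>2 + b\<^sub>3" "a\<^sub>1 + a\<^sub>3 \<le> b\<^sub>1 + b\<^sub>3"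
  shows "\<lceil>a\<^sub>1\<rceil> + \<lceil>a\<^sub>2\<rceil> + \<lceil>a\<^sub>3\<rceil> \<le> \<lceil>b\<^sub>1\<rceil> + \<lceil>b\<^sub>2\<rceil> + \<lceil>b\<^sub>3\<rceil> + 1"
proof -
  \<comment> \<open>The left side is strictly less than \<open>x + y + 2\<close>, hence than the sum
    of the other two ceilings plus 2; both sides are integers.\<close>
  have pair: "\<lceil>x\<rceil> + \<lceil>y\<rceil> \<le> \<lceil>z\<rceil> + \<lceil>w\<rceil> + 1" if "x + y \<le> z + w" for x y z w :: real
    using that by linarith
  show ?thesis using pair[OF assms(1)] pair[OF assms(2)] pair[OF assms(3)] by linarith
qed

section \<open>Finite graphs: degree sums, forests and stars\<close>

abbreviation all_pairs :: "'v set \<Rightarrow> 'v set set" where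
  "all_pairs V \<equiv> {{u, v} | u v. u \<in> V \<and> v \<in> V \<and> u \<noteq> v}"

lemma finite_all_pairs:
  assumes "finite V"
  shows "finite (all_pairs V)"
  by (rule finite_subset[of _ "Pow V"]) (use assms in auto)

lemma handshake:
  assumes "finite V" "E \<subseteq> all_pairs V"
  shows "(\<Sum>v\<in>V. card {e \<in> E. v \<in> e}) = 2 * card E"
proof -
  have fin: "finite E" using assms finite_all_pairs finite_subset by blast
  have "(\<Sum>v\<in>V. card {e \<in> E. v \<in> e}) = (\<Sum>v\<in>V. \<Sum>e\<in>E. if v \<in> e then 1 else 0)"
    using fin by (intro sum.cong) (simp_all add: sum.If_cases Int_def)
  also have "\<dots> = (\<Sum>e\<in>E. \<Sum>v\<in>V. if v \<in> e then 1 else 0)"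
    by (rule sum.swap)
  also have "\<dots> = (\<Sum>e\<in>E. 2)"
  proof (rule sum.cong[OF refl])
    fix e assume "e \<in> E"
    then obtain u w where e: "e = {u, w}" "u \<in> V" "w \<in> V" "u \<noteq> w" using assms by auto
    then have "{v \<in> V. v \<in> e} = {u, w}" by auto
    then show "(\<Sum>v\<in>V. if v \<in> e then 1 else 0) = (2::nat)"
      using assms(1) e(4) by (simp add: sum.If_cases Int_def)
  qed
  finally show ?thesis by simp
qed

text \<open>In a graph of minimum degree two, the first vertex of a longest path has a second neighbour,
  which lies on that path and closes a cycle.\<close>

lemma min_degree_two_has_cycle:
  assumes fin: "finite V" and ne: "V \<noteq> {}" and E: "E \<subseteq> all_pairs V"
    and deg: "\<And>v. v \<in> V \<Longrightarrow> 2 \<le> card {e \<in> E. v \<in> e}"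
  shows "\<exists>vs. is_cycle E vs"
proof -
  define P where "P vs \<longleftrightarrow> vs \<noteq> [] \<and> distinct vs \<and> set vs \<subseteq> V \<and>
    (\<forall>i. Suc i < length vs \<longrightarrow> {vs ! i, vs ! Suc i} \<in> E)" for vs
  have bound: "length vs \<le> card V" if "P vs" for vs
    using that fin unfolding P_def by (metis card_mono distinct_card)
  obtain v0 where "v0 \<in> V" using ne by blast
  then have "P [v0]" by (simp add: P_def)
  then obtain vs where vs: "P vs" and longest: "\<And>ws. P ws \<Longrightarrow> length ws \<le> length vs"
    using ex_has_greatest_nat[of P "[v0]" length "Suc (card V)"] bound by (metis less_Suc_eq_le)
  define x where "x = hd vs"
  have x: "vs ! 0 = x" "x \<in> V" "x \<in> set vs" using vs by (auto simp: P_def x_def hd_conv_nth)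
  \<comment> \<open>If the path is a single vertex, \<open>vs ! 1\<close> is an unspecified value.
    The argument still works, because it only uses that the right-hand set has one element.\<close>
  have "\<not> {e \<in> E. x \<in> e} \<subseteq> {{x, vs ! 1}}"
    using deg[OF x(2)] card_mono[of "{{x, vs ! 1}}" "{e \<in> E. x \<in> e}"] by auto
  then obtain e where e: "e \<in> E" "x \<in> e" "e \<noteq> {x, vs ! 1}" by blast
  then obtain y where y: "e = {y, x}" "y \<in> V" "y \<noteq> x" using E by blast
  have "\<not> P (y # vs)" using longest[of "y # vs"] by auto
  moreover have "P (y # vs)" if "y \<notin> set vs"
    unfolding P_def
  proof (intro conjI allI impI)
    fix i assume "Suc i < length (y # vs)"
    then show "{(y # vs) ! i, (y # vs) ! Suc i} \<in> E"
      using vs e y x(1) by (cases i) (auto simp: P_def)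
  qed (use that vs y in \<open>auto simp: P_def\<close>)
  ultimately have "y \<in> set vs" by blast
  then obtain j where j: "j < length vs" "vs ! j = y" by (auto simp: in_set_conv_nth)
  \<comment> \<open>The neighbour \<open>y\<close> differs from \<open>x\<close>, and
    \<open>e\<close> is not the first edge of the path. So the segment from \<open>x\<close> to
    \<open>y\<close> has at least three vertices, and \<open>e\<close> closes it.\<close>
  have "j \<noteq> 0" "j \<noteq> 1" using j y x(1) e(3) by (auto simp: insert_commute intro: ccontr)
  have "is_cycle E (take (Suc j) vs)"
    unfolding is_cycle_def
  proof (intro conjI allI impI)
    show "3 \<le> length (take (Suc j) vs)" using j \<open>j \<noteq> 0\<close> \<open>j \<noteq> 1\<close> by auto
    show "distinct (take (Suc j) vs)" using vs by (simp add: P_def)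
    fix i assume "i < length (take (Suc j) vs)"
    then have i: "i \<le> j" using j by auto
    have len: "length (take (Suc j) vs) = Suc j" using j by auto
    show "{take (Suc j) vs ! i, take (Suc j) vs ! (Suc i mod length (take (Suc j) vs))} \<in> E"
    proof (cases "i = j")
      case True
      then show ?thesis using j x(1) y e unfolding len by (simp add: nth_take)
    next
      case False
      then have "i < j" using i by simp
      then show ?thesis using vs j unfolding len P_def by (simp add: nth_take)
    qed
  qed
  then show ?thesis by blast
qed

text \<open>Some vertex has degree at most one, since minimum degree two forces a cycle. Deleting it
  costs one vertex and at most one edge.\<close>

lemma acyclic_card_edges:
  assumes "finite V" "V \<noteq> {}" "E \<subseteq> all_pairs V" "\<nexists>vs. is_cycle E vs"
  shows "card E < card V"
  using assms
proof (induction "card V" arbitrary: V E rule: less_induct)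
  case less
  have finE: "finite E" using less.prems finite_all_pairs finite_subset by blast
  obtain v where v: "v \<in> V" "card {e \<in> E. v \<in> e} \<le> 1"
    using min_degree_two_has_cycle[OF less.prems(1-3)] less.prems(4)
    by (metis Suc_1 not_less_eq_eq)
  show ?case
  proof (cases "V = {v}")
    case True
    then have "E = {}" using less.prems(3) by auto
    then show ?thesis using True by simp
  next
    case False
    let ?E = "{e \<in> E. v \<notin> e}"
    have "?E \<subseteq> all_pairs (V - {v})"
    proof
      fix e assume "e \<in> ?E"
      then obtain a b where "e = {a, b}" "a \<in> V" "b \<in> V" "a \<noteq> b" "v \<notin> e"
        using less.prems(3) by blast
      then show "e \<in> all_pairs (V - {v})" by blast
    qed
    moreover have "\<nexists>vs. is_cycle ?E vs" using less.prems(4) by (auto simp: is_cycle_def)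
    moreover have "card (V - {v}) < card V" using v less.prems(1) by (metis card_Diff1_less)
    ultimately have "card ?E < card (V - {v})"
      using less.hyps[of "V - {v}" ?E] less.prems False v by auto
    moreover have "card E = card ?E + card {e \<in> E. v \<in> e}"
      using finE by (subst card_Un_disjoint[symmetric]) (auto intro: arg_cong[where f = card])
    moreover have "card (V - {v}) = card V - 1" "0 < card V"
      using v less.prems(1) card_gt_0_iff by auto
    ultimately show ?thesis using v(2) by linarith
  qed
qed

lemma tree_degree_pos:
  assumes "is_tree V E" "v \<in> V" "w \<in> V" "v \<noteq> w"
  shows "0 < card {e \<in> E. v \<in> e}"
proof -
  have "finite E" using assms(1) finite_all_pairs finite_subset unfolding is_tree_def by blast
  have "(v, w) \<in> {(x, y). {x, y} \<in> E}\<^sup>*" using assms unfolding is_tree_def by blast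
  then obtain u where "{v, u} \<in> E" using assms(4) by (auto elim: converse_rtranclE)
  then have "{e \<in> E. v \<in> e} \<noteq> {}" by blast
  then show ?thesis using \<open>finite E\<close> by (simp add: card_gt_0_iff)
qed

text \<open>Two consecutive edges of a cycle share only their middle vertex, so the centre would
  have to be \<open>vs ! 1\<close>; the third edge misses that vertex.\<close>

lemma star_acyclic:
  assumes "\<And>e. e \<in> E \<Longrightarrow> s \<in> e"
  shows "\<nexists>vs. is_cycle E vs"
proof
  assume "\<exists>vs. is_cycle E vs"
  then obtain vs where len: "3 \<le> length vs" and dist: "distinct vs"
      and cyc: "\<And>i. i < length vs \<Longrightarrow> {vs ! i, vs ! (Suc i mod length vs)} \<in> E"
    unfolding is_cycle_def by blast
  have neq: "vs ! i \<noteq> vs ! j" if "i < length vs" "j < length vs" "i \<noteq> j" for i j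
    using that dist by (simp add: nth_eq_iff_index_eq)
  \<comment> \<open>The far end of the third edge: index 0 in a triangle, index 3 in a longer
    cycle.\<close>
  define k where "k = Suc 2 mod length vs"
  have k: "k < length vs" "k \<noteq> 1" using len by (cases "length vs = 3"; auto simp: k_def)+
  have c: "s \<in> {vs ! i, vs ! (Suc i mod length vs)}" if "i < length vs" for i
    using assms cyc that by blast
  have lt: "0 < length vs" "1 < length vs" "2 < length vs" using len by linarith+
  have "Suc 0 mod length vs = 1" "Suc 1 mod length vs = 2" using len by simp_all
  then have "s \<in> {vs ! 0, vs ! 1}" "s \<in> {vs ! 1, vs ! 2}" "s \<in> {vs ! 2, vs ! k}"
    using c[OF lt(1)] c[OF lt(2)] c[OF lt(3)] unfolding k_def by metis+
  moreover have "vs ! 0 \<noteq> vs ! 2" "vs ! 1 \<noteq> vs ! 2" "vs ! 1 \<noteq> vs ! k"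
    using neq[OF lt(1,3)] neq[OF lt(2,3)] neq[OF lt(2) k(1)] k(2) by simp_all
  ultimately show False by auto
qed

section \<open>Edge lengths and what splitting preserves\<close>

text \<open>An edge can be written as a pair in two orders; symmetry of the norm makes the described
  value unique.\<close>

lemma edge_length_pair:
  assumes "is_norm \<nu>"
  shows "edge_length \<nu> T {u, v} = \<nu> (pos T u - pos T v)"
  unfolding edge_length_def metric_of_def
  by (rule the_equality) (auto simp: doubleton_eq_iff is_norm_commute[OF assms])

text \<open>Splitting a Steiner point may leave it with degree two, so being a tree that interconnects \<open>N\<close>
  is not an invariant of splitting; this weaker property is.\<close>

definition well_formed :: "'t set \<Rightarrow> 't net \<Rightarrow> bool" where
  "well_formed N T \<longleftrightarrow> finite (steiner T) \<and> edges T \<subseteq> all_pairs (nodes N T)"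

lemma finite_nodes: "finite N \<Longrightarrow> finite (steiner T) \<Longrightarrow> finite (nodes N T)"
  by (simp add: nodes_def)

lemma card_nodes:
  assumes "finite N" "finite (steiner T)"
  shows "card (nodes N T) = card N + card (steiner T)"
  unfolding nodes_def using assms
  by (subst card_Un_disjoint) (auto simp: card_image inj_on_def)

lemma well_formed_finite_edges: "finite N \<Longrightarrow> well_formed N T \<Longrightarrow> finite (edges T)"
  unfolding well_formed_def by (elim conjE, erule finite_subset) (intro finite_all_pairs finite_nodes)

lemma interconnects_well_formed:
  assumes "interconnects N p T"
  shows "well_formed N T"
proof -
  have "finite (nodes N T)" using assms unfolding interconnects_def is_tree_def by blast
  then have "finite (steiner T)" by (simp add: nodes_def finite_image_iff inj_on_def)
  then show ?thesis using assms by (simp add: interconnects_def is_tree_def well_formed_def)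
qed

text \<open>The new point sits where \<open>v\<close> does, so a moved edge keeps its length and the
  extra edge has length zero. Freshness of the label keeps moved, unmoved and extra edges apart, so
  exactly one edge is gained.\<close>

lemma split_node_invariants:
  assumes "is_norm \<nu>" "finite N" "well_formed N T" "split_node N T T'"
  shows "well_formed N T'" "card (steiner T') = Suc (card (steiner T))"
    "card (edges T') = Suc (card (edges T))"
    "pos T' (Terminal t) = pos T (Terminal t)"
    "(\<Sum>e\<in>edges T'. edge_length \<nu> T' e) = (\<Sum>e\<in>edges T. edge_length \<nu> T e)"
proof -
  obtain v F s where v: "v \<in> nodes N T" and F: "F \<subseteq> edges_at T v" and s: "s \<notin> steiner T"
    and T': "T' = T\<lparr>steiner := insert s (steiner T),
        edges := (edges T - F) \<union> (\<lambda>e. insert (Steiner s) (e - {v})) ` F \<union> {{Steiner s, v}},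
        pos := (pos T)(Steiner s := pos T v)\<rparr>"
    using assms(4) by (auto elim: split_node.cases)
  let ?f = "\<lambda>e. insert (Steiner s) (e - {v})"
  have fin: "finite (edges T)" by (rule well_formed_finite_edges[OF assms(2,3)])
  have E: "edges T \<subseteq> all_pairs (nodes N T)" and finS: "finite (steiner T)"
    using assms(3) by (auto simp: well_formed_def)
  have fresh: "Steiner s \<notin> nodes N T" using s by (auto simp: nodes_def)
  have old: "Steiner s \<notin> e" if "e \<in> edges T" for e using that E fresh by auto
  have FE: "F \<subseteq> edges T" using F by (auto simp: edges_at_def)
  have moved: "\<exists>u. e = {v, u} \<and> u \<noteq> v \<and> u \<in> nodes N T" if "e \<in> F" for e
    using that F E unfolding edges_at_def by blast
  have fF: "\<exists>u. e = {v, u} \<and> ?f e = {Steiner s, u} \<and> u \<noteq> v \<and> u \<in> nodes N T" if "e \<in> F" for e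
    using moved[OF that] by auto
  \<comment> \<open>The far end of an edge at \<open>v\<close> survives the move and determines the
    edge, so no two moved edges merge.\<close>
  have inj: "inj_on ?f F"
  proof (rule inj_onI)
    fix x y assume "x \<in> F" "y \<in> F" "?f x = ?f y"
    moreover obtain a b where "x = {v, a}" "?f x = {Steiner s, a}" "y = {v, b}" "?f y = {Steiner s, b}"
      using fF \<open>x \<in> F\<close> \<open>y \<in> F\<close> by meson
    ultimately show "x = y" by (auto simp: doubleton_eq_iff)
  qed
  have disj: "(edges T - F) \<inter> ?f ` F = {}" "{Steiner s, v} \<notin> edges T - F \<union> ?f ` F"
  proof -
    show "(edges T - F) \<inter> ?f ` F = {}" using old by blast
    show "{Steiner s, v} \<notin> edges T - F \<union> ?f ` F"
    proof
      assume "{Steiner s, v} \<in> edges T - F \<union> ?f ` F"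
      moreover have "{Steiner s, v} \<notin> edges T" using old by blast
      ultimately obtain e where "e \<in> F" "?f e = {Steiner s, v}" by auto
      then show False using fF[of e] v fresh by (auto simp: doubleton_eq_iff)
    qed
  qed
  have edges': "edges T' = insert {Steiner s, v} ((edges T - F) \<union> ?f ` F)" by (simp add: T')
  have nodes': "nodes N T' = insert (Steiner s) (nodes N T)" by (simp add: T' nodes_def)
  have finF: "finite F" "finite (edges T - F)" "finite (?f ` F)"
    using fin FE finite_subset by auto
  have "edges T' \<subseteq> all_pairs (nodes N T')"
  proof
    fix e assume "e \<in> edges T'"
    then consider "e = {Steiner s, v}" | "e \<in> edges T" | g where "g \<in> F" "e = ?f g"
      unfolding edges' by blast
    then show "e \<in> all_pairs (nodes N T')"
    proof cases
      case 1
      then show ?thesis using v fresh unfolding nodes' by blast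
    next
      case 2
      then show ?thesis using E unfolding nodes' by blast
    next
      case 3
      then obtain u where "e = {Steiner s, u}" "u \<in> nodes N T" using fF by metis
      then show ?thesis using fresh unfolding nodes' by blast
    qed
  qed
  then show "well_formed N T'" using finS by (simp add: well_formed_def T')
  show "card (steiner T') = Suc (card (steiner T))" using finS s by (simp add: T')
  have "card (edges T') = Suc (card (edges T - F) + card (?f ` F))"
    unfolding edges' using disj finF by (simp add: card_Un_disjoint)
  also have "card (?f ` F) = card F" by (rule card_image[OF inj])
  also have "card (edges T - F) + card F = card (edges T)"
    using FE fin finF by (simp add: card_Diff_subset card_mono)
  finally show "card (edges T') = Suc (card (edges T))" .
  show "pos T' (Terminal t) = pos T (Terminal t)" by (simp add: T')
  have pos': "pos T' u = pos T u" if "u \<noteq> Steiner s" for u using that by (simp add: T')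
  have pos_s: "pos T' (Steiner s) = pos T v" by (simp add: T')
  have "\<nu> 0 = 0" using assms(1) unfolding is_norm_def by blast
  moreover have "v \<noteq> Steiner s" using v fresh by blast
  ultimately have new: "edge_length \<nu> T' {Steiner s, v} = 0"
    by (simp add: edge_length_pair[OF assms(1)] pos' pos_s)
  have kept: "edge_length \<nu> T' e = edge_length \<nu> T e" if e: "e \<in> edges T - F" for e
  proof -
    obtain a b where "e = {a, b}" using e E by blast
    then show ?thesis using old[of e] e by (auto simp: edge_length_pair[OF assms(1)] pos')
  qed
  have fmoved: "edge_length \<nu> T' (?f e) = edge_length \<nu> T e" if e: "e \<in> F" for e
  proof -
    obtain u where u: "e = {v, u}" "?f e = {Steiner s, u}" "u \<in> nodes N T" using fF[OF e] by blast
    then have "u \<noteq> Steiner s" using fresh by blast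
    then show ?thesis
      by (subst u(2), subst u(1)) (simp add: edge_length_pair[OF assms(1)] pos' pos_s)
  qed
  have "(\<Sum>e\<in>edges T'. edge_length \<nu> T' e) =
      (\<Sum>e\<in>edges T - F. edge_length \<nu> T' e) + (\<Sum>e\<in>?f ` F. edge_length \<nu> T' e)"
    unfolding edges' using disj finF new by (simp add: sum.union_disjoint)
  also have "\<dots> = (\<Sum>e\<in>edges T - F. edge_length \<nu> T e) + (\<Sum>e\<in>F. edge_length \<nu> T e)"
    using inj by (simp add: sum.reindex kept fmoved)
  also have "\<dots> = (\<Sum>e\<in>edges T. edge_length \<nu> T e)"
    using FE fin by (simp add: sum.subset_diff)
  finally show "(\<Sum>e\<in>edges T'. edge_length \<nu> T' e) = (\<Sum>e\<in>edges T. edge_length \<nu> T e)" .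
qed

text \<open>Each splitting adds one edge and one Steiner point, so the difference of the two counts
  is constant; it is stated additively to avoid subtraction of naturals.\<close>

lemma split_nodes_invariants:
  assumes "is_norm \<nu>" "finite N" "well_formed N T" "(split_node N)\<^sup>*\<^sup>* T T'"
  shows "well_formed N T' \<and> card (edges T') + card (steiner T) = card (edges T) + card (steiner T') \<and>
    (\<forall>t. pos T' (Terminal t) = pos T (Terminal t)) \<and>
    (\<Sum>e\<in>edges T'. edge_length \<nu> T' e) = (\<Sum>e\<in>edges T. edge_length \<nu> T e)"
  using assms(4)
proof (induction rule: rtranclp_induct)
  case base
  then show ?case using assms(3) by simp
next
  case (step T' T'')
  then show ?case using split_node_invariants[OF assms(1,2) _ step.hyps(2)] by simp
qed

section \<open>Trees on three terminals and their full splittings\<close>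

lemma degree_eq: "degree T v = card {e \<in> edges T. v \<in> e}"
  by (simp add: degree_def edges_at_def)

lemma sum_degree:
  assumes "finite N" "well_formed N T"
  shows "(\<Sum>t\<in>N. degree T (Terminal t)) + (\<Sum>s\<in>steiner T. degree T (Steiner s)) = 2 * card (edges T)"
proof -
  have "2 * card (edges T) = (\<Sum>v\<in>nodes N T. degree T v)"
    using handshake[of "nodes N T" "edges T"] assms finite_nodes[of N T]
    by (simp add: degree_eq well_formed_def)
  also have "\<dots> = (\<Sum>v\<in>Terminal ` N. degree T v) + (\<Sum>v\<in>Steiner ` steiner T. degree T v)"
    unfolding nodes_def using assms by (subst sum.union_disjoint) (auto simp: well_formed_def)
  finally show ?thesis by (simp add: sum.reindex inj_on_def)
qed

lemma interconnects_degree_pos: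
  assumes "interconnects N p T" "2 \<le> card N" "t \<in> N"
  shows "1 \<le> degree T (Terminal t)"
proof -
  have "\<not> N \<subseteq> {t}" using assms(2) card_mono[of "{t}" N] by auto
  then obtain u where "u \<in> N" "u \<noteq> t" by blast
  then show ?thesis
    using tree_degree_pos[of "nodes N T" "edges T" "Terminal t" "Terminal u"] assms
    by (auto simp: degree_eq interconnects_def nodes_def)
qed

text \<open>With k Steiner points the degrees add up to at least 3 + 3k, while acyclicity allows at
  most k + 2 edges, hence a degree sum of at most 2k + 4. So k is at most 1, and fewer than k + 2
  edges would be too few for the degrees.\<close>

lemma interconnects_three:
  assumes "interconnects N p T" "card N = 3"
  shows "card (steiner T) \<le> 1" "card (edges T) = card (steiner T) + 2"
proof -
  have fin: "finite N" using assms(2) card.infinite by fastforce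
  have wf: "well_formed N T" by (rule interconnects_well_formed[OF assms(1)])
  then have finS: "finite (steiner T)" by (simp add: well_formed_def)
  have "card N \<le> (\<Sum>t\<in>N. degree T (Terminal t))"
    using sum_mono[of N "\<lambda>_. 1" "\<lambda>t. degree T (Terminal t)"]
      interconnects_degree_pos[OF assms(1)] assms(2) by simp
  moreover have "3 * card (steiner T) \<le> (\<Sum>s\<in>steiner T. degree T (Steiner s))"
    using sum_mono[of "steiner T" "\<lambda>_. 3" "\<lambda>s. degree T (Steiner s)"] assms(1)
    by (simp add: interconnects_def mult.commute)
  moreover have "card (edges T) < card (nodes N T)"
    using assms(1) unfolding interconnects_def is_tree_def by (intro acyclic_card_edges) blast+
  ultimately show "card (steiner T) \<le> 1" "card (edges T) = card (steiner T) + 2"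
    using sum_degree[OF fin wf] card_nodes[OF fin finS] assms(2) by linarith+
qed

text \<open>This makes the choice in \<open>fully_split\<close> meaningful. A tree with a Steiner
  point is already a star; one without is a path, and splitting its middle terminal once
  suffices.\<close>

lemma full_splitting_exists:
  assumes "interconnects N p T" "card N = 3"
  shows "\<exists>T'. full_splitting N T T'"
proof -
  have fin: "finite N" using assms(2) card.infinite by fastforce
  have wf: "well_formed N T" by (rule interconnects_well_formed[OF assms(1)])
  then have finS: "finite (steiner T)" and E: "edges T \<subseteq> all_pairs (nodes N T)"
    by (simp_all add: well_formed_def)
  have finE: "finite (edges T)" by (rule well_formed_finite_edges[OF fin wf])
  note three = interconnects_three[OF assms]
  have deg1: "1 \<le> degree T (Terminal t)" if "t \<in> N" for t
    using interconnects_degree_pos[OF assms(1)] assms(2) that by simp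
  consider "card (steiner T) = 1" | "card (steiner T) = 0" using three(1) by linarith
  then show ?thesis
  proof cases
    case 1
    then obtain s where s: "steiner T = {s}" by (auto simp: card_1_singleton_iff)
    have sum: "(\<Sum>t\<in>N. degree T (Terminal t)) + degree T (Steiner s) = 6"
      using sum_degree[OF fin wf] three(2) s by simp
    have ge3: "3 \<le> degree T (Steiner s)" using assms(1) s by (simp add: interconnects_def)
    \<comment> \<open>The total 6 is already used up by the lower bounds 1 for each terminal and 3
      for the Steiner point, so every bound is attained.\<close>
    have "degree T (Terminal t) = 1" if t: "t \<in> N" for t
    proof -
      have "card (N - {t}) \<le> (\<Sum>t\<in>N - {t}. degree T (Terminal t))"
        using sum_mono[of "N - {t}" "\<lambda>_. 1" "\<lambda>t. degree T (Terminal t)"] deg1 by simp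
      then show ?thesis
        using sum ge3 deg1[OF t] fin t assms(2) by (simp add: sum.remove[of N t])
    qed
    moreover have "3 \<le> (\<Sum>t\<in>N. degree T (Terminal t))"
      using sum_mono[of N "\<lambda>_. 1" "\<lambda>t. degree T (Terminal t)"] deg1 assms(2) by simp
    then have "degree T (Steiner s) = 3" using sum ge3 by simp
    ultimately have "full_splitting N T T" using s by (simp add: full_splitting_def)
    then show ?thesis by blast
  next
    case 2
    then have S: "steiner T = {}" using finS by simp
    have nodes: "nodes N T = Terminal ` N" by (simp add: nodes_def S)
    have "(\<Sum>t\<in>N. degree T (Terminal t)) = 4" using sum_degree[OF fin wf] three(2) S by simp
    \<comment> \<open>A degree sum of 4 over three terminals forces a degree of at least 2, and
      there are only two edges: \<open>c\<close> is the middle of the path.\<close>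
    then obtain c where c: "c \<in> N" "2 \<le> degree T (Terminal c)"
      using sum_mono[of N "\<lambda>t. degree T (Terminal t)" "\<lambda>_. 1"] assms(2) by fastforce
    have "edges_at T (Terminal c) \<subseteq> edges T" by (auto simp: edges_at_def)
    moreover have "card (edges T) \<le> card (edges_at T (Terminal c))"
      using c(2) three(2) 2 by (simp add: degree_def)
    ultimately have at: "edges_at T (Terminal c) = edges T"
      using finE by (simp add: card_seteq)
    obtain e g where eg: "edges T = {e, g}" "e \<noteq> g"
      using three(2) unfolding 2 add_0 card_2_iff by blast
    have ends: "\<exists>x\<in>N. x \<noteq> c \<and> h = {Terminal c, Terminal x}" if h: "h \<in> edges T" for h
    proof -
      have c_in: "Terminal c \<in> h" using h at by (auto simp: edges_at_def)
      obtain u v where "h = {u, v}" "u \<in> Terminal ` N" "v \<in> Terminal ` N" "u \<noteq> v"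
        using subsetD[OF E h] unfolding nodes by blast
      with c_in show ?thesis by (auto simp: insert_commute)
    qed
    obtain x y where xy: "x \<in> N" "x \<noteq> c" "y \<in> N" "y \<noteq> c"
        "e = {Terminal c, Terminal x}" "g = {Terminal c, Terminal y}"
      using ends[of e] ends[of g] unfolding eg(1) by blast
    have "x \<noteq> y" using eg(2) xy by auto
    then have "card {x, y, c} = 3" using xy by simp
    then have N: "N = {x, y, c}"
      using xy c fin assms(2) card_seteq[of N "{x, y, c}"] by auto
    \<comment> \<open>Both edges move from \<open>c\<close> to the new point, leaving
      \<open>c\<close> as a third leaf. The label 0 is fresh because there were no Steiner
      points.\<close>
    define T' where "T' = T\<lparr>steiner := insert 0 (steiner T),
        edges := (edges T - edges T) \<union>
          (\<lambda>e. insert (Steiner 0) (e - {Terminal c})) ` edges T \<union> {{Steiner 0, Terminal c}},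
        pos := (pos T)(Steiner 0 := pos T (Terminal c))\<rparr>"
    have "split_node N T T'"
      unfolding T'_def using c at S eg by (intro split_node.intros) (auto simp: nodes)
    moreover have edges': "edges T' = {{Steiner 0, Terminal x}, {Steiner 0, Terminal y}, {Steiner 0, Terminal c}}"
      using xy by (auto simp: T'_def eg)
    have at': "edges_at T' (Terminal t) = {{Steiner 0, Terminal t}}" if "t \<in> {x, y, c}" for t
      using that xy \<open>x \<noteq> y\<close> unfolding edges_at_def edges' by auto
    have "edges_at T' (Steiner 0) = edges T'" unfolding edges_at_def edges' by auto
    moreover have "card (edges T') = 3"
      using xy \<open>x \<noteq> y\<close> by (simp add: edges' doubleton_eq_iff)
    moreover have "steiner T' = {0}" by (simp add: T'_def S)
    ultimately have "full_splitting N T T'"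
      unfolding full_splitting_def N using at' by (auto simp: degree_def)
    then show ?thesis by blast
  qed
qed

text \<open>Splitting keeps the number of edges equal to k + 2 for k Steiner points, so the
  prescribed degrees give 3 + 3k = 2(k + 2). Hence k = 1, and all three edges meet the one Steiner
  point.\<close>

lemma full_splitting_star:
  assumes "is_norm \<nu>" "interconnects N p T" "card N = 3" "full_splitting N T T'"
  obtains s where "edges T' = (\<lambda>t. {Steiner s, Terminal t}) ` N"
proof -
  have fin: "finite N" using assms(3) card.infinite by fastforce
  have wf: "well_formed N T" by (rule interconnects_well_formed[OF assms(2)])
  have split: "(split_node N)\<^sup>*\<^sup>* T T'" and d1: "\<And>t. t \<in> N \<Longrightarrow> degree T' (Terminal t) = 1"
      and d3: "\<And>s. s \<in> steiner T' \<Longrightarrow> degree T' (Steiner s) = 3"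
    using assms(4) by (auto simp: full_splitting_def)
  note inv = split_nodes_invariants[OF assms(1) fin wf split]
  have wf': "well_formed N T'" using inv by blast
  have finE: "finite (edges T')" by (rule well_formed_finite_edges[OF fin wf'])
  have cardE: "card (edges T') = card (steiner T') + 2"
    using inv interconnects_three(2)[OF assms(2,3)] by simp
  then have "card (steiner T') = 1" using sum_degree[OF fin wf'] d1 d3 assms(3) by simp
  then obtain s where s: "steiner T' = {s}" by (auto simp: card_1_singleton_iff)
  have "edges_at T' (Steiner s) = edges T'"
    using finE d3[of s] s cardE by (intro card_seteq) (auto simp: edges_at_def degree_def)
  then have centre: "Steiner s \<in> e" if "e \<in> edges T'" for e
    using that by (auto simp: edges_at_def)
  have "edges T' \<subseteq> (\<lambda>t. {Steiner s, Terminal t}) ` N"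
  proof
    fix e assume e: "e \<in> edges T'"
    then obtain u v where "e = {u, v}" "u \<in> nodes N T'" "v \<in> nodes N T'" "u \<noteq> v"
      using wf' unfolding well_formed_def by blast
    moreover have "x = Steiner s \<or> x \<in> Terminal ` N" if "x \<in> nodes N T'" for x
      using that s by (auto simp: nodes_def)
    ultimately obtain x where "e = {Steiner s, x}" "x \<in> Terminal ` N"
      using centre[OF e] by (metis insert_commute insert_iff singletonD)
    then show "e \<in> (\<lambda>t. {Steiner s, Terminal t}) ` N" by blast
  qed
  \<comment> \<open>The star has no more edges than \<open>T'\<close>, so the inclusion just shown
    is an equality.\<close>
  moreover have "card ((\<lambda>t. {Steiner s, Terminal t}) ` N) \<le> card (edges T')"
    using card_image_le[OF fin, of "\<lambda>t. {Steiner s, Terminal t}"] cardE assms(3) unfolding s by simp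
  ultimately have "edges T' = (\<lambda>t. {Steiner s, Terminal t}) ` N"
    by (intro card_seteq finite_imageI fin)
  then show thesis by (rule that)
qed

lemma sum_star:
  "(\<Sum>e\<in>(\<lambda>t. {Steiner s, Terminal t}) ` N. f e) = (\<Sum>t\<in>N. f {Steiner s, Terminal t})"
  by (subst sum.reindex) (auto simp: inj_on_def doubleton_eq_iff)

text \<open>Length is measured on \<open>T\<close> but beads on its full splitting. As splitting
  preserves length, both can be read off from one star with the same centre
  \<open>q\<close>.\<close>

lemma three_terminals_star:
  assumes "is_norm \<nu>" "interconnects N p T" "card N = 3"
  obtains q where "(\<Sum>e\<in>edges T. edge_length \<nu> T e) = (\<Sum>t\<in>N. \<nu> (p t - q))"
    "beads \<nu> N T = (\<Sum>t\<in>N. \<lceil>\<nu> (p t - q)\<rceil>) - 2"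
proof -
  have fin: "finite N" using assms(3) card.infinite by fastforce
  have wf: "well_formed N T" by (rule interconnects_well_formed[OF assms(2)])
  let ?T = "fully_split N T"
  have full: "full_splitting N T ?T"
    unfolding fully_split_def by (rule someI_ex[OF full_splitting_exists[OF assms(2,3)]])
  obtain s where s: "edges ?T = (\<lambda>t. {Steiner s, Terminal t}) ` N"
    using full_splitting_star[OF assms full] .
  have inv: "pos ?T (Terminal t) = pos T (Terminal t)"
      "(\<Sum>e\<in>edges ?T. edge_length \<nu> ?T e) = (\<Sum>e\<in>edges T. edge_length \<nu> T e)" for t
    using split_nodes_invariants[OF assms(1) fin wf, of ?T] full by (simp_all add: full_splitting_def)
  have len: "edge_length \<nu> ?T {Steiner s, Terminal t} = \<nu> (p t - pos ?T (Steiner s))" if "t \<in> N" for t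
    using assms(2) that inv(1)
    by (simp add: edge_length_pair[OF assms(1)] is_norm_commute[OF assms(1), of _ "p t"] interconnects_def)
  show thesis
  proof
    show "(\<Sum>e\<in>edges T. edge_length \<nu> T e) = (\<Sum>t\<in>N. \<nu> (p t - pos ?T (Steiner s)))"
      using inv(2) len by (simp add: s sum_star)
    show "beads \<nu> N T = (\<Sum>t\<in>N. \<lceil>\<nu> (p t - pos ?T (Steiner s))\<rceil>) - 2"
      using len by (simp add: beads_def s sum_star assms(3))
  qed
qed

section \<open>Comparison with the star at the median\<close>

text \<open>This supplies competitors for minimality. The centre may be placed anywhere, even on a
  terminal, since nodes are labels.\<close>

lemma star_interconnects:
  assumes "3 \<le> card N"
  shows "interconnects N p \<lparr>steiner = {s}, edges = (\<lambda>t. {Steiner s, Terminal t}) ` N,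
    pos = case_node p (\<lambda>_. q)\<rparr>" (is "interconnects N p ?T")
proof -
  have fin: "finite N" using assms card.infinite by fastforce
  have nodes: "nodes N ?T = insert (Steiner s) (Terminal ` N)" by (auto simp: nodes_def)
  have "edges_at ?T (Steiner s) = edges ?T" by (auto simp: edges_at_def)
  moreover have "inj_on (\<lambda>t. {Steiner s, Terminal t}) N"
    by (auto simp: inj_on_def doubleton_eq_iff)
  ultimately have deg: "degree ?T (Steiner s) = card N" by (simp add: degree_def card_image)
  let ?R = "{(x, y). {x, y} \<in> edges ?T}"
  have adj: "(Steiner s, Terminal t) \<in> ?R" "(Terminal t, Steiner s) \<in> ?R" if "t \<in> N" for t
    using that by (auto simp: insert_commute)
  have "(u, Steiner s) \<in> ?R\<^sup>*" "(Steiner s, u) \<in> ?R\<^sup>*" if "u \<in> nodes N ?T" for u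
    using that adj unfolding nodes by blast+
  then have "\<forall>u\<in>nodes N ?T. \<forall>v\<in>nodes N ?T. (u, v) \<in> ?R\<^sup>*" by (meson rtrancl_trans)
  moreover have "\<nexists>vs. is_cycle (edges ?T) vs" by (rule star_acyclic[of _ "Steiner s"]) auto
  moreover have "edges ?T \<subseteq> all_pairs (nodes N ?T)" unfolding nodes by fastforce
  ultimately have "is_tree (nodes N ?T) (edges ?T)"
    using fin unfolding is_tree_def nodes by blast
  then show ?thesis using deg assms by (simp add: interconnects_def)
qed

theorem proposition11:
  fixes \<nu> :: "real ^ 2 \<Rightarrow> real"
    and N :: "'t set"
    and p :: "'t \<Rightarrow> real ^ 2"
    and T\<^sub>S T\<^sub>o\<^sub>p\<^sub>t :: "'t net"
  assumes "is_norm \<nu>"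
    and "is_parallelogram (unit_ball \<nu>)"
    and "card N = 3"
    and "is_SMT \<nu> N p T\<^sub>S"
    and "is_MSPT \<nu> N p T\<^sub>o\<^sub>p\<^sub>t"
  shows "beads \<nu> N T\<^sub>S \<le> beads \<nu> N T\<^sub>o\<^sub>p\<^sub>t + 1"
proof -
  note norm = assms(1)
  obtain x y z where N: "N = {x, y, z}" "x \<noteq> y" "y \<noteq> z" "x \<noteq> z"
    using assms(3) by (auto simp: card_3_iff)
  have S: "interconnects N p T\<^sub>S" and opt: "interconnects N p T\<^sub>o\<^sub>p\<^sub>t"
    using assms(4,5) by (auto simp: is_SMT_def is_MSPT_def)
  obtain q where q: "(\<Sum>e\<in>edges T\<^sub>S. edge_length \<nu> T\<^sub>S e) = (\<Sum>t\<in>N. \<nu> (p t - q))"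
      "beads \<nu> N T\<^sub>S = (\<Sum>t\<in>N. \<lceil>\<nu> (p t - q)\<rceil>) - 2"
    using three_terminals_star[OF norm S assms(3)] .
  obtain r where r: "beads \<nu> N T\<^sub>o\<^sub>p\<^sub>t = (\<Sum>t\<in>N. \<lceil>\<nu> (p t - r)\<rceil>) - 2"
    using three_terminals_star[OF norm opt assms(3)] by metis
  obtain m where m: "\<nu> (p x - m) + \<nu> (p y - m) = \<nu> (p x - p y)"
      "\<nu> (p y - m) + \<nu> (p z - m) = \<nu> (p y - p z)"
      "\<nu> (p x - m) + \<nu> (p z - m) = \<nu> (p x - p z)"
    using parallelogram_norm_median[OF norm assms(2)] .
  \<comment> \<open>The star centred at the median; its length is half the perimeter of the terminal
    triangle.\<close>
  define M :: "'t net" where "M = \<lparr>steiner = {0},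
    edges = (\<lambda>t. {Steiner 0, Terminal t}) ` N, pos = case_node p (\<lambda>_. m)\<rparr>"
  have "interconnects N p M" unfolding M_def by (rule star_interconnects) (simp add: assms(3))
  then have "(\<Sum>t\<in>N. \<nu> (p t - q)) \<le> (\<Sum>e\<in>edges M. edge_length \<nu> M e)"
    using assms(4) q(1) by (simp add: is_SMT_def)
  also have "\<dots> = (\<Sum>t\<in>N. \<nu> (p t - m))"
    by (simp add: M_def sum_star edge_length_pair[OF norm] is_norm_commute[OF norm, of m])
  finally have "\<nu> (p x - q) + \<nu> (p y - q) + \<nu> (p z - q) \<le> \<nu> (p x - m) + \<nu> (p y - m) + \<nu> (p z - m)"
    using N by simp
  moreover note m is_norm_diff_triangle[OF norm, of "p x" "p y"]
    is_norm_diff_triangle[OF norm, of "p y" "p z"] is_norm_diff_triangle[OF norm, of "p x" "p z"]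
  \<comment> \<open>The distances from \<open>q\<close> total at most half the perimeter, while the
    three triangle inequalities through \<open>q\<close> add up to the reverse bound. So each of
    them is an equality, and the triangle inequalities through \<open>r\<close> finish the
    comparison.\<close>
  ultimately have "\<nu> (p x - q) + \<nu> (p y - q) \<le> \<nu> (p x - r) + \<nu> (p y - r)"
      "\<nu> (p y - q) + \<nu> (p z - q) \<le> \<nu> (p y - r) + \<nu> (p z - r)"
      "\<nu> (p x - q) + \<nu> (p z - q) \<le> \<nu> (p x - r) + \<nu> (p z - r)"
    by (smt (verit))+
  from sum_ceiling_le_of_pairwise[OF this] show ?thesis using q(2) r N by simp
qed

end
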